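(* Let $n\ge1$ and let $f(z,\overline z)$ be a real-valued polynomial of degree $m$ in $z$ and $\overline z$ on $\mathbf{C}^n$ (not necessarily homogeneous) such that $f(z,\overline z)>0$ for all $z$ on the unit sphere $\{\|z\|=1\}$. Then there is an integer $N\ge1$ and a holomorphic polynomial mapping $g:\mathbf{C}^n\to\mathbf{C}^N$ such that $f(z,\overline z)=\|g(z)\|^2$ for all $z$ on the unit sphere.
   Context: $\|\cdot\|$ denotes the complex Euclidean norm. A polynomial in $z$ and $\overline z$ is a finite sum $\sum c_{\alpha\beta}z^\alpha\overline z^\beta$ with complex coefficients, $\alpha,\beta$ multi-indices. *)

theory Defs
  imports "HOL-Analysis.Analysis" "HOL-Library.Poly_Mapping"
begin

text \<open>Multi-indices on \<open>\<complex>\<^sup>n\<close>, with \<open>n = CARD('n)\<close>, are functions \<open>'n \<Rightarrow> nat\<close>.\<close>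

type_synonym 'n multi_index = "'n \<Rightarrow> nat"

definition mi_degree :: "'n::finite multi_index \<Rightarrow> nat" where
  "mi_degree \<alpha> = (\<Sum>i\<in>UNIV. \<alpha> i)"

definition monomial_at :: "complex ^ 'n \<Rightarrow> 'n::finite multi_index \<Rightarrow> complex" where
  "monomial_at z \<alpha> = (\<Prod>i\<in>UNIV. (z $ i) ^ \<alpha> i)"

definition conj_vec :: "complex ^ 'n \<Rightarrow> complex ^ 'n::finite" where
  "conj_vec z = (\<chi> i. cnj (z $ i))"

text \<open>A polynomial in \<open>z\<close> and \<open>conj z\<close> is its finitely supported coefficient family
  \<open>(\<alpha>, \<beta>) \<mapsto> c\<^bsub>\<alpha>\<beta>\<^esub>\<close>.\<close>

type_synonym 'n zzbar_poly = "('n multi_index \<times> 'n multi_index) \<Rightarrow>\<^sub>0 complex"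

definition zzbar_eval :: "'n::finite zzbar_poly \<Rightarrow> complex ^ 'n \<Rightarrow> complex" where
  "zzbar_eval f z =
    (\<Sum>(\<alpha>, \<beta>)\<in>Poly_Mapping.keys f.
      Poly_Mapping.lookup f (\<alpha>, \<beta>) * monomial_at z \<alpha> * monomial_at (conj_vec z) \<beta>)"

text \<open>Total degree in \<open>z\<close> and \<open>conj z\<close> jointly; the zero polynomial gets degree 0.\<close>

definition zzbar_degree :: "'n::finite zzbar_poly \<Rightarrow> nat" where
  "zzbar_degree f =
    Max (insert 0 ((\<lambda>(\<alpha>, \<beta>). mi_degree \<alpha> + mi_degree \<beta>) ` Poly_Mapping.keys f))"

definition zzbar_real_valued :: "'n::finite zzbar_poly \<Rightarrow> bool" where
  "zzbar_real_valued f \<longleftrightarrow> (\<forall>z. zzbar_eval f z \<in> \<real>)"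

definition hol_poly_fun :: "(complex ^ 'n::finite \<Rightarrow> complex) \<Rightarrow> bool" where
  "hol_poly_fun h \<longleftrightarrow>
    (\<exists>c :: 'n multi_index \<Rightarrow>\<^sub>0 complex.
      \<forall>z. h z = (\<Sum>\<alpha>\<in>Poly_Mapping.keys c. Poly_Mapping.lookup c \<alpha> * monomial_at z \<alpha>))"

text \<open>As \<open>N\<close> is existentially quantified in the theorem, a vector of \<open>\<complex>\<^sup>N\<close> is a function
  \<open>nat \<Rightarrow> complex\<close> of which only the values at \<open>0, \<dots>, N - 1\<close> are considered.\<close>

definition hol_poly_map :: "nat \<Rightarrow> (complex ^ 'n::finite \<Rightarrow> nat \<Rightarrow> complex) \<Rightarrow> bool" where
  "hol_poly_map N g \<longleftrightarrow> (\<forall>j<N. hol_poly_fun (\<lambda>z. g z j))"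

definition cnorm :: "nat \<Rightarrow> (nat \<Rightarrow> complex) \<Rightarrow> real" where
  "cnorm N w = L2_set (\<lambda>j. cmod (w j)) {..<N}"

end

theory Submission
  imports Defs "HOL-Library.Function_Algebras"
begin

text \<open>
  The functions which agree on the sphere with some \<open>\<parallel>g\<parallel>\<^sup>2\<close>, \<open>g\<close> a holomorphic polynomial map, form
  a semiring \<open>T\<close>. On the sphere \<open>1 - |z\<^sub>i|\<^sup>2\<close> is the sum of the other \<open>|z\<^sub>j|\<^sup>2\<close>, and
  \<open>2 (1 + Re (u z\<^sub>i)) = |1 + u z\<^sub>i|\<^sup>2 + (1 - |z\<^sub>i|\<^sup>2)\<close> for \<open>|u| = 1\<close>; hence real and imaginary parts
  of the coordinates, and so all real polynomials, are bounded with respect to \<open>T\<close>. Thus \<open>T\<close> is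
  archimedean, and by the Kadison--Dubois theorem an element which is positive under every
  \<open>T\<close>-nonnegative character lies in \<open>T\<close>. A character is determined by its values at the
  coordinates, that is, it is the evaluation at a point, which lies on the sphere because
  \<open>1 - \<parallel>z\<parallel>\<^sup>2\<close> and its negative belong to \<open>T\<close>.
\<close>

section \<open>Real algebra structure on functions\<close>

instantiation "fun" :: (type, real_vector) real_vector
begin

definition scaleR_fun :: "real \<Rightarrow> ('a \<Rightarrow> 'b) \<Rightarrow> 'a \<Rightarrow> 'b" where
  "scaleR_fun r f = (\<lambda>x. r *\<^sub>R f x)"

instance
  by standard (auto simp: scaleR_fun_def fun_eq_iff algebra_simps)

end

text \<open>Together with the pointwise ring structure this allows the Kadison--Dubois theorem,
  stated for a type class, to be applied to real functions on complex space.\<close>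

instance "fun" :: (type, real_algebra_1) real_algebra_1
  by standard (auto simp: scaleR_fun_def fun_eq_iff)

lemma of_real_fun_apply [simp]: "(of_real r :: 'a \<Rightarrow> 'b::real_algebra_1) x = of_real r"
  by (simp add: of_real_def scaleR_fun_def)

lemma of_real_fun: "of_real r = (\<lambda>_. of_real r)"
  by (rule ext) simp

section \<open>The Kadison--Dubois theorem\<close>

text \<open>Read \<open>t \<in> T\<close> as nonnegativity of \<open>t\<close>: only an upper bound
  is assumed, since \<open>0\<close> already bounds \<open>t\<close> from below.\<close>

locale archimedean_semiring =
  fixes T :: "'a::{real_algebra_1, comm_ring_1} set"
  assumes add: "s \<in> T \<Longrightarrow> t \<in> T \<Longrightarrow> s + t \<in> T"
    and mult: "s \<in> T \<Longrightarrow> t \<in> T \<Longrightarrow> s * t \<in> T"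
    and of_real: "0 \<le> r \<Longrightarrow> of_real r \<in> T"
    and archimedean: "t \<in> T \<Longrightarrow> \<exists>k. of_real k - t \<in> T"

text \<open>These \<open>a\<close> lie between \<open>- k\<close> and \<open>k\<close> in the
  preorder with cone \<open>T\<close>. The definition stands outside the locale because for the
  sphere the archimedean axiom is itself deduced from boundedness.\<close>

definition bounded_elements :: "'a::{real_algebra_1, comm_ring_1} set \<Rightarrow> 'a set" where
  "bounded_elements T = {a. \<exists>k. of_real k - a \<in> T \<and> of_real k + a \<in> T}"

text \<open>\<phi> is a total function, so the algebraic laws are demanded on the algebra of bounded
  elements only.\<close>

definition nonneg_character ::
    "'a::{real_algebra_1, comm_ring_1} set \<Rightarrow> ('a \<Rightarrow> real) \<Rightarrow> bool" where
  "nonneg_character T \<phi> \<longleftrightarrow>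
    (\<forall>a\<in>bounded_elements T. \<forall>b\<in>bounded_elements T.
       \<phi> (a + b) = \<phi> a + \<phi> b \<and> \<phi> (a * b) = \<phi> a * \<phi> b) \<and>
    (\<forall>r. \<phi> (of_real r) = r) \<and> (\<forall>t\<in>T. 0 \<le> \<phi> t)"

section \<open>Arithmetic of bounded elements\<close>

lemma bounded_elements_add:
  assumes add: "\<And>s t. s \<in> T \<Longrightarrow> t \<in> T \<Longrightarrow> s + t \<in> T"
    and "a \<in> bounded_elements T" "b \<in> bounded_elements T"
  shows "a + b \<in> bounded_elements T"
proof -
  obtain k l where
    "of_real k - a \<in> T" "of_real k + a \<in> T" "of_real l - b \<in> T" "of_real l + b \<in> T"
    using assms unfolding bounded_elements_def by blast
  then have "(of_real k - a) + (of_real l - b) \<in> T" "(of_real k + a) + (of_real l + b) \<in> T"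
    by (auto intro: add)
  then show ?thesis
    unfolding bounded_elements_def
    by (intro CollectI exI[of _ "k + l"]) (simp add: algebra_simps)
qed

lemma bounded_elements_uminus:
  "a \<in> bounded_elements T \<Longrightarrow> - a \<in> bounded_elements T"
  unfolding bounded_elements_def by auto

lemma bounded_elements_of_real:
  assumes "\<And>r. 0 \<le> r \<Longrightarrow> of_real r \<in> T"
  shows "of_real r \<in> bounded_elements T"
  unfolding bounded_elements_def
  using assms[of "\<bar>r\<bar> - r"] assms[of "\<bar>r\<bar> + r"]
  by (intro CollectI exI[of _ "\<bar>r\<bar>"]) simp

text \<open>In \<open>(k - a) * (l + b) + (k + a) * (l - b)\<close> and its companion the mixed
  terms cancel, leaving twice \<open>k * l - a * b\<close> and twice
  \<open>k * l + a * b\<close>.\<close>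

lemma bounded_elements_mult:
  assumes add: "\<And>s t. s \<in> T \<Longrightarrow> t \<in> T \<Longrightarrow> s + t \<in> T"
    and mult: "\<And>s t. s \<in> T \<Longrightarrow> t \<in> T \<Longrightarrow> s * t \<in> T"
    and of_real: "\<And>r. 0 \<le> r \<Longrightarrow> of_real r \<in> T"
    and "a \<in> bounded_elements T" "b \<in> bounded_elements T"
  shows "a * b \<in> bounded_elements T"
proof -
  obtain k l where
    kl: "of_real k - a \<in> T" "of_real k + a \<in> T" "of_real l - b \<in> T" "of_real l + b \<in> T"
    using assms unfolding bounded_elements_def by blast
  have half: "of_real (1/2) \<in> T"
    by (rule of_real) simp
  have two: "of_real (1/2) * (x + x) = x" for x :: 'a
    by (simp add: of_real_def flip: scaleR_2)
  have "of_real (1/2) * ((of_real k - a) * (of_real l + b) + (of_real k + a) * (of_real l - b)) \<in> T"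
    "of_real (1/2) * ((of_real k + a) * (of_real l + b) + (of_real k - a) * (of_real l - b)) \<in> T"
    using kl half by (auto intro!: add mult)
  moreover have "(of_real k - a) * (of_real l + b) + (of_real k + a) * (of_real l - b)
      = (of_real (k*l) - a * b) + (of_real (k*l) - a * b)"
    "(of_real k + a) * (of_real l + b) + (of_real k - a) * (of_real l - b)
      = (of_real (k*l) + a * b) + (of_real (k*l) + a * b)"
    by (simp_all add: algebra_simps)
  ultimately show ?thesis
    unfolding bounded_elements_def by (intro CollectI exI[of _ "k * l"]) (simp only: two)
qed

context archimedean_semiring
begin

abbreviation "B \<equiv> bounded_elements T"

lemma zero: "0 \<in> T" and one: "1 \<in> T"
  using of_real[of 0] of_real[of 1] by simp_all

lemma subset_bounded: "T \<subseteq> B"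
proof
  fix t assume t: "t \<in> T"
  then obtain k where k: "of_real k - t \<in> T" using archimedean by blast
  have "of_real \<bar>k\<bar> - t = (of_real k - t) + of_real (\<bar>k\<bar> - k)"
    by simp
  then have "of_real \<bar>k\<bar> - t \<in> T"
    using add[OF k of_real[of "\<bar>k\<bar> - k"]] by simp
  moreover have "of_real \<bar>k\<bar> + t \<in> T"
    using t of_real add by simp
  ultimately show "t \<in> B"
    unfolding bounded_elements_def by blast
qed

lemma bounded_obtain_pos:
  assumes "a \<in> B"
  obtains k where "0 < k" "of_real k - a \<in> T" "of_real k + a \<in> T"
proof -
  obtain k where k: "of_real k - a \<in> T" "of_real k + a \<in> T"
    using assms unfolding bounded_elements_def by blast
  have "(of_real k - a) + of_real (\<bar>k\<bar> + 1 - k) \<in> T" "(of_real k + a) + of_real (\<bar>k\<bar> + 1 - k) \<in> T"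
    by (rule add[OF _ of_real]; use k in simp)+
  then show thesis
    by (intro that[of "\<bar>k\<bar> + 1"]) (simp_all add: algebra_simps)
qed

lemmas B_add = bounded_elements_add[OF add]
  and B_mult = bounded_elements_mult[OF add mult of_real]
  and B_of_real = bounded_elements_of_real[OF of_real]

lemma B_diff: "a \<in> B \<Longrightarrow> b \<in> B \<Longrightarrow> a - b \<in> B"
  using B_add[of a "- b"] bounded_elements_uminus[of b T] by simp

section \<open>Maximal proper modules over \<open>T\<close>\<close>

definition proper_module :: "'a set \<Rightarrow> bool" where
  "proper_module M \<longleftrightarrow> T \<subseteq> M \<and> (\<forall>x\<in>M. \<forall>y\<in>M. x + y \<in> M) \<and>
     (\<forall>t\<in>T. \<forall>x\<in>M. t * x \<in> M) \<and> - 1 \<notin> M"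

lemma proper_moduleI:
  assumes "\<And>x y. x \<in> M \<Longrightarrow> y \<in> M \<Longrightarrow> x + y \<in> M" "\<And>t x. t \<in> T \<Longrightarrow> x \<in> M \<Longrightarrow> t * x \<in> M"
    and "T \<subseteq> M" "- 1 \<notin> M"
  shows "proper_module M"
  using assms unfolding proper_module_def by blast

text \<open>Zorn's lemma: two elements of the union of a chain lie in a common member, so the union
  is again a proper module.\<close>

lemma maximal_proper_module_exists:
  assumes "proper_module M\<^sub>0"
  obtains M where "proper_module M" "M\<^sub>0 \<subseteq> M"
    "\<And>M'. proper_module M' \<Longrightarrow> M \<subseteq> M' \<Longrightarrow> M' = M"
proof -
  let ?\<A> = "{M. proper_module M \<and> M\<^sub>0 \<subseteq> M}"
  have "\<exists>M\<in>?\<A>. \<forall>X\<in>?\<A>. M \<subseteq> X \<longrightarrow> X = M"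
  proof (rule subset_Zorn_nonempty)
    show "?\<A> \<noteq> {}" using assms by blast
    fix C assume ne: "C \<noteq> {}" and C: "subset.chain ?\<A> C"
    have sub: "C \<subseteq> ?\<A>" and tot: "\<And>X Y. X \<in> C \<Longrightarrow> Y \<in> C \<Longrightarrow> X \<subseteq> Y \<or> Y \<subseteq> X"
      using C unfolding subset_chain_def by blast+
    have "x + y \<in> \<Union>C" if xy: "x \<in> \<Union>C" "y \<in> \<Union>C" for x y
    proof -
      obtain X Y where XY: "X \<in> C" "Y \<in> C" "x \<in> X" "y \<in> Y" using xy by blast
      then obtain Z where "Z \<in> C" "x \<in> Z" "y \<in> Z" using tot by blast
      then show ?thesis using sub unfolding proper_module_def by blast
    qed
    then have "proper_module (\<Union>C)"
      using ne sub unfolding proper_module_def by blast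
    then show "\<Union>C \<in> ?\<A>" using ne sub by blast
  qed
  then obtain M where M: "proper_module M" "M\<^sub>0 \<subseteq> M" "\<forall>X\<in>?\<A>. M \<subseteq> X \<longrightarrow> X = M"
    by blast
  show thesis
  proof (rule that)
    fix M' assume "proper_module M'" "M \<subseteq> M'"
    with M show "M' = M" by blast
  qed (use M in auto)
qed

text \<open>Otherwise adjoining \<open>a\<close> or \<open>- a\<close> to \<open>M\<close> would
  produce \<open>- 1\<close>. Eliminating \<open>a\<close> from the two relations puts
  \<open>- t\<close> in \<open>M\<close>, and an upper bound of \<open>a\<close> then puts
  \<open>- 1\<close> in \<open>M\<close>. As \<open>M\<close> need not be closed under products, one
  factor always comes from \<open>T\<close>.\<close>

lemma maximal_proper_module_total:
  assumes M: "proper_module M"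
    and max: "\<And>M'. proper_module M' \<Longrightarrow> M \<subseteq> M' \<Longrightarrow> M' = M"
    and a: "a \<in> B"
  shows "a \<in> M \<or> - a \<in> M"
proof (rule ccontr)
  assume *: "\<not> (a \<in> M \<or> - a \<in> M)"
  have TM: "\<And>t. t \<in> T \<Longrightarrow> t \<in> M" and Madd: "\<And>x y. x \<in> M \<Longrightarrow> y \<in> M \<Longrightarrow> x + y \<in> M"
    and Mmult: "\<And>t x. t \<in> T \<Longrightarrow> x \<in> M \<Longrightarrow> t * x \<in> M" and Mproper: "- 1 \<notin> M"
    using M unfolding proper_module_def by blast+
  \<comment> \<open>\<open>?M\<close> is the module generated by \<open>M\<close> and
    \<open>b\<close>; by maximality it cannot be proper.\<close>
  have adjoin: "\<exists>m\<in>M. \<exists>t\<in>T. m + b * t = - 1" if b: "b \<notin> M" for b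
  proof (rule ccontr)
    assume no: "\<not> ?thesis"
    let ?M = "{m + b * t | m t. m \<in> M \<and> t \<in> T}"
    have sub: "M \<subseteq> ?M"
    proof
      fix m assume "m \<in> M"
      moreover have "m = m + b * 0" by simp
      ultimately show "m \<in> ?M" using zero by blast
    qed
    have "x + y \<in> ?M" if xy: "x \<in> ?M" "y \<in> ?M" for x y
    proof -
      obtain m t m' t' where "x = m + b * t" "y = m' + b * t'" "m \<in> M" "t \<in> T" "m' \<in> M" "t' \<in> T"
        using xy by blast
      then have "x + y = (m + m') + b * (t + t')" "m + m' \<in> M" "t + t' \<in> T"
        by (auto simp: algebra_simps intro: Madd add)
      then show ?thesis by blast
    qed
    moreover have "s * x \<in> ?M" if sx: "s \<in> T" "x \<in> ?M" for s x
    proof -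
      obtain m t where "x = m + b * t" "m \<in> M" "t \<in> T"
        using sx by blast
      then have "s * x = s * m + b * (s * t)" "s * m \<in> M" "s * t \<in> T"
        using sx by (simp_all add: distrib_left mult.left_commute Mmult mult)
      then show ?thesis by blast
    qed
    moreover have "T \<subseteq> ?M" using TM sub by blast
    moreover have "- 1 \<notin> ?M"
    proof
      assume "- 1 \<in> ?M"
      then obtain m t where "- 1 = m + b * t" "m \<in> M" "t \<in> T" by blast
      with no show False by metis
    qed
    ultimately have "proper_module ?M" by (rule proper_moduleI)
    then have "?M = M" using max sub by blast
    moreover have "b = 0 + b * 1" by simp
    then have "b \<in> ?M" using TM zero one by blast
    ultimately show False using b by simp
  qed
  obtain m t where m: "m \<in> M" and t: "t \<in> T" and mt: "m + a * t = - 1"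
    using adjoin[of a] * by blast
  obtain n u where n: "n \<in> M" and u: "u \<in> T" and nu: "n + (- a) * u = - 1"
    using adjoin[of "- a"] * by blast
  have at: "a * t = - 1 - m" and au: "a * u = 1 + n"
    using mt nu by (auto simp: algebra_simps eq_neg_iff_add_eq_0)
  \<comment> \<open>Multiplying the relation for \<open>a * t\<close> by \<open>u\<close> and the
    one for \<open>a * u\<close> by \<open>t\<close> eliminates \<open>a\<close>.\<close>
  have "- t - (u * m + t * n + u) = u * (a * t) - t * (a * u)"
    unfolding at au by (simp add: algebra_simps)
  also have "\<dots> = 0" by (simp add: mult.left_commute mult.commute)
  finally have "- t = u * m + t * n + u" by simp
  then have neg_t: "- t \<in> M"
    using m n t u TM by (simp add: Madd Mmult)
  obtain k where k: "0 < k" "of_real k - a \<in> T"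
    using a by (rule bounded_obtain_pos)
  \<comment> \<open>Here \<open>a * t\<close> is split as \<open>(k - a) * (- t) + k * t\<close>,
    with both summands in \<open>M\<close>.\<close>
  have "of_real k * t \<in> M"
    using t k TM mult of_real by simp
  moreover have "(of_real k - a) * (- t) \<in> M" using Mmult neg_t k by blast
  ultimately have "(of_real k - a) * (- t) + of_real k * t + m \<in> M" using m Madd by blast
  moreover have "(of_real k - a) * (- t) + of_real k * t + m = - 1"
    using at by (simp add: algebra_simps)
  ultimately show False using Mproper by simp
qed

text \<open>\<open>M\<close> orders \<open>B\<close> totally and with real bounds, so each
  \<open>a\<close> in \<open>B\<close> has a standard part \<open>\<phi> a\<close>, the real number
  infinitely close to it. Nonnegativity on \<open>M\<close>, not just on \<open>T\<close>, is what
  the Kadison--Dubois argument applies to \<open>- f\<close>.\<close>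

lemma maximal_proper_module_character:
  assumes M: "proper_module M"
    and max: "\<And>M'. proper_module M' \<Longrightarrow> M \<subseteq> M' \<Longrightarrow> M' = M"
  obtains \<phi> where "nonneg_character T \<phi>" "\<And>a. a \<in> B \<Longrightarrow> a \<in> M \<Longrightarrow> 0 \<le> \<phi> a"
proof -
  have TM: "\<And>t. t \<in> T \<Longrightarrow> t \<in> M" and Madd: "\<And>x y. x \<in> M \<Longrightarrow> y \<in> M \<Longrightarrow> x + y \<in> M"
    and Mmult: "\<And>t x. t \<in> T \<Longrightarrow> x \<in> M \<Longrightarrow> t * x \<in> M" and Mproper: "- 1 \<notin> M"
    using M unfolding proper_module_def by blast+
  have total: "b \<in> M \<or> - b \<in> M" if "b \<in> B" for b
    using M max that by (rule maximal_proper_module_total)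
  \<comment> \<open>A negative real in \<open>M\<close> could be rescaled to
    \<open>- 1\<close>.\<close>
  have Mreal: "0 \<le> r" if "of_real r \<in> M" for r
  proof (rule ccontr)
    assume r: "\<not> 0 \<le> r"
    then have "of_real (1 / (- r)) * of_real r \<in> M"
      using that by (intro Mmult of_real) auto
    then show False using r Mproper by (simp flip: of_real_mult)
  qed
  \<comment> \<open>The infinitesimals of the total preorder with cone \<open>M\<close>: the bounded ones form an ideal of
    \<open>B\<close>, and each element of \<open>B\<close> differs from exactly one real constant by an infinitesimal.\<close>
  define Z where "Z a \<longleftrightarrow> (\<forall>e>0. of_real e + a \<in> M \<and> of_real e - a \<in> M)" for a
  have Z_add: "Z (a + b)" if "Z a" "Z b" for a b
    unfolding Z_def
  proof (intro allI impI)
    fix e :: real assume "e > 0"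
    then have "of_real (e/2) + a \<in> M" "of_real (e/2) + b \<in> M"
      "of_real (e/2) - a \<in> M" "of_real (e/2) - b \<in> M"
      using that half_gt_zero[of e] unfolding Z_def by blast+
    then have "(of_real (e/2) + a) + (of_real (e/2) + b) \<in> M"
      "(of_real (e/2) - a) + (of_real (e/2) - b) \<in> M"
      by (simp_all only: Madd)
    moreover have "of_real e = (of_real (e/2) + of_real (e/2) :: 'a)"
      by (simp flip: of_real_add)
    ultimately show "of_real e + (a + b) \<in> M \<and> of_real e - (a + b) \<in> M"
      by (simp add: algebra_simps)
  qed
  have Z_uminus: "Z (- a)" if "Z a" for a
    using that unfolding Z_def by simp
  have Z_T: "Z (t * a)" if a: "Z a" and t: "t \<in> T" for a t
    unfolding Z_def
  proof (intro allI impI)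
    fix e :: real assume e: "e > 0"
    obtain l where l: "0 < l" and lt: "of_real l - t \<in> T"
      using t subset_bounded bounded_obtain_pos by blast
    \<comment> \<open>The decomposition is
      \<open>e + t * a = t * (e/l + a) + (e/l) * (l - t)\<close>, and likewise for
      \<open>- a\<close>.\<close>
    have "of_real (e/l) * (of_real l - t) \<in> M"
      using lt e l by (intro TM mult of_real) auto
    moreover have "t * (of_real (e/l) + a) \<in> M" "t * (of_real (e/l) - a) \<in> M"
      using a e l t unfolding Z_def by (auto intro!: Mmult)
    ultimately have "t * (of_real (e/l) + a) + of_real (e/l) * (of_real l - t) \<in> M"
      "t * (of_real (e/l) - a) + of_real (e/l) * (of_real l - t) \<in> M"
      using Madd by blast+
    moreover have "of_real (e/l) * of_real l = (of_real e :: 'a)"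
      using l by (simp flip: of_real_mult)
    ultimately show "of_real e + t * a \<in> M \<and> of_real e - t * a \<in> M"
      by (simp add: algebra_simps)
  qed
  \<comment> \<open>\<open>Z_T\<close> covers multipliers in \<open>T\<close>; a general
    \<open>b\<close> is the difference of \<open>k + b\<close> and \<open>k\<close>, both in
    \<open>T\<close>.\<close>
  have Z_mult: "Z (b * a)" if a: "Z a" and b: "b \<in> B" for a b
  proof -
    obtain k where k: "0 < k" "of_real k + b \<in> T"
      using b by (rule bounded_obtain_pos)
    then have "Z (of_real k * a)" using Z_T a of_real by simp
    moreover have "Z ((of_real k + b) * a)" using Z_T a k by blast
    ultimately have "Z ((of_real k + b) * a + - (of_real k * a))" using Z_add Z_uminus by blast
    then show ?thesis by (simp add: algebra_simps)
  qed
  have Z_real: "c = 0" if c: "Z (of_real c)" for c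
  proof (rule ccontr)
    assume "c \<noteq> 0"
    then have "of_real (\<bar>c\<bar> / 2) + of_real c \<in> M" "of_real (\<bar>c\<bar> / 2) - of_real c \<in> M"
      using c unfolding Z_def by auto
    then have "0 \<le> \<bar>c\<bar> / 2 + c" "0 \<le> \<bar>c\<bar> / 2 - c"
      using Mreal[of "\<bar>c\<bar> / 2 + c"] Mreal[of "\<bar>c\<bar> / 2 - c"]
      by (simp_all only: of_real_add of_real_diff)
    then show False using \<open>c \<noteq> 0\<close> by linarith
  qed
  have Z_ex: "\<exists>c. Z (a - of_real c)" if a: "a \<in> B" for a
  proof -
    obtain k where k: "of_real k + a \<in> T" "of_real k - a \<in> T"
      using a unfolding bounded_elements_def by blast
    \<comment> \<open>The standard part is the supremum of the reals below \<open>a\<close>, as in a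
      Dedekind cut.\<close>
    define S where "S = {r. a - of_real r \<in> M}"
    have ne: "- k \<in> S" unfolding S_def using k TM by (simp add: algebra_simps)
    have bd: "bdd_above S"
    proof (rule bdd_aboveI)
      fix r assume "r \<in> S"
      then have "(of_real k - a) + (a - of_real r) \<in> M" unfolding S_def using k TM Madd by blast
      then show "r \<le> k" using Mreal[of "k - r"] by simp
    qed
    have "Z (a - of_real (Sup S))"
      unfolding Z_def
    proof (intro allI impI conjI)
      fix e :: real assume e: "e > 0"
      then obtain r where r: "r \<in> S" "r > Sup S - e"
        using less_cSup_iff[of S "Sup S - e"] ne bd by auto
      have "a - of_real r \<in> M" using r(1) unfolding S_def by simp
      then have "of_real (r - Sup S + e) + (a - of_real r) \<in> M"
        using r(2) by (intro Madd TM[OF of_real]) simp_all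
      then show "of_real e + (a - of_real (Sup S)) \<in> M"
        by (simp add: algebra_simps)
      have "Sup S + e \<notin> S" 
      proof
        assume "Sup S + e \<in> S"
        then have "Sup S + e \<le> Sup S" using bd by (rule cSup_upper)
        with e show False by simp
      qed
      then have "a - of_real (Sup S + e) \<notin> M" unfolding S_def by simp
      moreover have "a - of_real (Sup S + e) \<in> B" using a B_diff B_of_real by blast
      ultimately have "- (a - of_real (Sup S + e)) \<in> M"
        using total by blast
      then show "of_real e - (a - of_real (Sup S)) \<in> M" by (simp add: algebra_simps)
    qed
    then show ?thesis by blast
  qed
  have Z_unique: "c = d" if "Z (a - of_real c)" "Z (a - of_real d)" for a c d
    using Z_add[OF that(1) Z_uminus[OF that(2)]] Z_real[of "d - c"] by simp
  define \<phi> where "\<phi> a = (THE c. Z (a - of_real c))" for a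
  have \<phi>: "Z (a - of_real (\<phi> a))" if "a \<in> B" for a
    using theI'[of "\<lambda>c. Z (a - of_real c)"] Z_ex[OF that] Z_unique unfolding \<phi>_def by blast
  have \<phi>_eq: "\<phi> a = c" if "Z (a - of_real c)" for a c
    using that Z_unique unfolding \<phi>_def by blast
  have nonneg: "0 \<le> \<phi> a" if a: "a \<in> B" "a \<in> M" for a
  proof (rule ccontr)
    assume neg: "\<not> 0 \<le> \<phi> a"
    \<comment> \<open>Adding the estimate for \<open>e = - \<phi> a / 2\<close> to \<open>a\<close>
      would leave the negative real \<open>\<phi> a / 2\<close> in \<open>M\<close>.\<close>
    then have "0 < - \<phi> a / 2" by simp
    then have "of_real (- \<phi> a / 2) - (a - of_real (\<phi> a)) \<in> M"
      using \<phi>[OF a(1)] unfolding Z_def by blast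
    then have "of_real (- \<phi> a / 2) - (a - of_real (\<phi> a)) + a \<in> M" using a Madd by blast
    moreover have "of_real (- \<phi> a / 2) - (a - of_real (\<phi> a)) + a = of_real (- \<phi> a / 2 + \<phi> a)"
      by (simp only: of_real_add) simp
    ultimately have "of_real (- \<phi> a / 2 + \<phi> a) \<in> M" by (simp only:)
    then show False using Mreal[of "- \<phi> a / 2 + \<phi> a"] neg by simp
  qed
  have "\<phi> (a + b) = \<phi> a + \<phi> b \<and> \<phi> (a * b) = \<phi> a * \<phi> b" if a: "a \<in> B" and b: "b \<in> B" for a b
  proof
    show "\<phi> (a + b) = \<phi> a + \<phi> b"
      using Z_add[OF \<phi>[OF a] \<phi>[OF b]] by (intro \<phi>_eq) (simp add: algebra_simps)
    \<comment> \<open>The argument of \<open>Z\<close> equals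
      \<open>a * b - \<phi> a * \<phi> b\<close>.\<close>
    have "Z (b * (a - of_real (\<phi> a)) + of_real (\<phi> a) * (b - of_real (\<phi> b)))"
      by (intro Z_add Z_mult \<phi> a b B_of_real)
    then show "\<phi> (a * b) = \<phi> a * \<phi> b"
      by (intro \<phi>_eq) (simp add: algebra_simps)
  qed
  moreover have "\<phi> (of_real r) = r" for r
    by (rule \<phi>_eq) (simp add: Z_def TM of_real)
  moreover have "0 \<le> \<phi> t" if "t \<in> T" for t
    using nonneg[of t] subset_bounded TM that by blast
  ultimately have "nonneg_character T \<phi>"
    unfolding nonneg_character_def by simp
  then show thesis using nonneg that by blast
qed

text \<open>If the module generated by \<open>T\<close> and \<open>- f\<close> were proper, the
  character of a maximal module above it would be nonnegative at \<open>- f\<close>. Hence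
  \<open>f * t = 1 + s\<close> with \<open>s\<close> and \<open>t\<close> in \<open>T\<close>, and
  this lets a constant \<open>r\<close> with \<open>f + r\<close> in \<open>T\<close> be lowered by
  a fixed amount until it is no longer positive.\<close>

theorem kadison_dubois:
  assumes f: "f \<in> B" and pos: "\<And>\<phi>. nonneg_character T \<phi> \<Longrightarrow> 0 < \<phi> f"
  shows "f \<in> T"
proof -
  let ?M = "{s - f * t | s t. s \<in> T \<and> t \<in> T}"
  have "- 1 \<in> ?M"
  proof (rule ccontr)
    assume proper: "- 1 \<notin> ?M"
    have "x + y \<in> ?M" if xy: "x \<in> ?M" "y \<in> ?M" for x y
    proof -
      obtain s t s' t' where "x = s - f * t" "y = s' - f * t'" "s \<in> T" "t \<in> T" "s' \<in> T" "t' \<in> T"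
        using xy by blast
      then have "x + y = (s + s') - f * (t + t')" "s + s' \<in> T" "t + t' \<in> T"
        by (auto simp: algebra_simps intro: add)
      then show ?thesis by blast
    qed
    moreover have "u * x \<in> ?M" if ux: "u \<in> T" "x \<in> ?M" for u x
    proof -
      obtain s t where "x = s - f * t" "s \<in> T" "t \<in> T"
        using ux by blast
      then have "u * x = u * s - f * (u * t)" "u * s \<in> T" "u * t \<in> T"
        using ux by (auto simp: algebra_simps intro: mult)
      then show ?thesis by blast
    qed
    moreover have "T \<subseteq> ?M"
    proof
      fix s assume "s \<in> T"
      moreover have "s = s - f * 0" by simp
      ultimately show "s \<in> ?M" using zero by blast
    qed
    ultimately have "proper_module ?M" using proper by (rule proper_moduleI)
    then obtain M where M: "proper_module M" "?M \<subseteq> M"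
      "\<And>M'. proper_module M' \<Longrightarrow> M \<subseteq> M' \<Longrightarrow> M' = M"
      using maximal_proper_module_exists by blast
    obtain \<phi> where \<phi>: "nonneg_character T \<phi>" "\<And>a. a \<in> B \<Longrightarrow> a \<in> M \<Longrightarrow> 0 \<le> \<phi> a"
      using maximal_proper_module_character[OF M(1,3)] by blast
    have "- f = 0 - f * 1" by simp
    then have "- f \<in> ?M" using zero one by blast
    then have "0 \<le> \<phi> (- f)" using \<phi>(2) M(2) f bounded_elements_uminus by blast
    moreover have "\<phi> (f + - f) = \<phi> f + \<phi> (- f)" "\<phi> (of_real 0) = 0"
      using \<phi>(1) f bounded_elements_uminus unfolding nonneg_character_def by blast+
    ultimately show False using pos[OF \<phi>(1)] by simp
  qed
  then obtain s t where s: "s \<in> T" and t: "t \<in> T" and "- 1 = s - f * t" by blast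
  then have ft: "f * t = 1 + s" by (simp add: algebra_simps)
  obtain l where l: "0 < l" and lt: "of_real l - t \<in> T"
    using t subset_bounded bounded_obtain_pos by blast
  \<comment> \<open>Since \<open>f t = 1 + s\<close>, expanding \<open>(l - t) (f + r) \<in> T\<close> shows \<open>l (f + r) - 1 \<in> T\<close>.\<close>
  have step: "f + of_real (r - 1 / l) \<in> T" if r: "0 \<le> r" "f + of_real r \<in> T" for r
  proof -
    have "of_real (1 / l) * ((of_real l - t) * (f + of_real r) + s + of_real r * t) \<in> T"
      using mult[OF of_real add[OF add[OF mult[OF lt r(2)] s] mult[OF of_real t]]] r(1) l by simp
    moreover have "(of_real l - t) * (f + of_real r) + s + of_real r * t
        = of_real l * (f + of_real r) - 1"
      using ft by (simp add: algebra_simps)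
    moreover have "of_real (1 / l) * (of_real l * (f + of_real r) - 1) = f + of_real (r - 1 / l)"
    proof -
      have "of_real (1 / l) * (of_real l * x) = x" for x :: 'a
        using l by (simp flip: of_real_mult mult.assoc)
      then show ?thesis by (simp add: right_diff_distrib)
    qed
    ultimately show ?thesis by simp
  qed
  obtain c where c: "of_real c + f \<in> T" using f unfolding bounded_elements_def by blast
  have "\<exists>r\<le>0. f + of_real r \<in> T"
  proof (rule ccontr)
    assume no: "\<not> ?thesis"
    \<comment> \<open>At every stage \<open>no\<close> supplies the nonnegativity that
      \<open>step\<close> requires; yet the constants drop below \<open>0\<close> after finitely
      many stages, against \<open>no\<close>.\<close>
    have "f + of_real (c - real j / l) \<in> T" for j
    proof (induction j)
      case (Suc j)
      then have "0 \<le> c - real j / l" using no by (meson linear)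
      from step[OF this Suc] show ?case by (simp add: algebra_simps add_divide_distrib)
    qed (use c in \<open>simp add: add.commute\<close>)
    moreover obtain j :: nat where "c * l \<le> real j" using real_arch_simple by blast
    then have "c - real j / l \<le> 0" using l by (simp add: field_simps)
    ultimately show False using no by blast
  qed
  then obtain r where "r \<le> 0" "f + of_real r \<in> T" by blast
  then have "(f + of_real r) + of_real (- r) \<in> T" using add of_real by (simp del: add_uminus_conv_diff of_real_minus)
  then show ?thesis by simp
qed

end

section \<open>Polynomial functions\<close>

text \<open>\<open>P\<close> is arbitrary because the rule is applied to polynomial functions, to
  squared norms on the sphere and to induction predicates.\<close>

lemma sum_closed:
  assumes "finite I" "\<And>i. i \<in> I \<Longrightarrow> P (u i)"
    and "P (\<lambda>_. 0)" "\<And>h k. P h \<Longrightarrow> P k \<Longrightarrow> P (\<lambda>z. h z + k z)"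
  shows "P (\<lambda>z. \<Sum>i\<in>I. u i z :: 'a::comm_monoid_add)"
  using assms(1,2) by (induction I rule: finite_induct) (simp_all add: assms(3,4))

lemma prod_closed:
  assumes "finite I" "\<And>i. i \<in> I \<Longrightarrow> P (u i)"
    and "P (\<lambda>_. 1)" "\<And>h k. P h \<Longrightarrow> P k \<Longrightarrow> P (\<lambda>z. h z * k z)"
  shows "P (\<lambda>z. \<Prod>i\<in>I. u i z :: 'a::comm_monoid_mult)"
  using assms(1,2) by (induction I rule: finite_induct) (simp_all add: assms(3,4))

lemma power_closed:
  assumes "P u" "P (\<lambda>_. 1)" "\<And>h k. P h \<Longrightarrow> P k \<Longrightarrow> P (\<lambda>z. h z * k z)"
  shows "P (\<lambda>z. u z ^ n :: 'a::monoid_mult)"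
  using assms by (induction n) simp_all

text \<open>Coefficients may cancel in a sum, so key sets differ; padding with zero coefficients
  gives a common index set.\<close>

lemma lookup_sum_extend_keys:
  assumes "finite K" "Poly_Mapping.keys c \<subseteq> K"
  shows "(\<Sum>\<alpha>\<in>Poly_Mapping.keys c. Poly_Mapping.lookup c \<alpha> * u \<alpha>)
    = (\<Sum>\<alpha>\<in>K. Poly_Mapping.lookup c \<alpha> * u \<alpha> :: complex)"
  using assms by (intro sum.mono_neutral_left) (auto simp: in_keys_iff)

lemma hol_poly_fun_monomial: "hol_poly_fun (\<lambda>z. c * monomial_at z \<alpha>)"
  unfolding hol_poly_fun_def by (rule exI[of _ "Poly_Mapping.single \<alpha> c"]) simp

lemma hol_poly_fun_add:
  assumes "hol_poly_fun h" "hol_poly_fun k"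
  shows "hol_poly_fun (\<lambda>z. h z + k z)"
proof -
  obtain c d where
    c: "\<And>z. h z = (\<Sum>\<alpha>\<in>Poly_Mapping.keys c. Poly_Mapping.lookup c \<alpha> * monomial_at z \<alpha>)" and
    d: "\<And>z. k z = (\<Sum>\<alpha>\<in>Poly_Mapping.keys d. Poly_Mapping.lookup d \<alpha> * monomial_at z \<alpha>)"
    using assms unfolding hol_poly_fun_def by blast
  let ?K = "Poly_Mapping.keys c \<union> Poly_Mapping.keys d"
  have "h z + k z = (\<Sum>\<alpha>\<in>Poly_Mapping.keys (c + d). Poly_Mapping.lookup (c + d) \<alpha> * monomial_at z \<alpha>)"
    for z
  proof -
    have "h z = (\<Sum>\<alpha>\<in>?K. Poly_Mapping.lookup c \<alpha> * monomial_at z \<alpha>)"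
      "k z = (\<Sum>\<alpha>\<in>?K. Poly_Mapping.lookup d \<alpha> * monomial_at z \<alpha>)"
      unfolding c d by (rule lookup_sum_extend_keys; simp)+
    moreover have "(\<Sum>\<alpha>\<in>Poly_Mapping.keys (c + d). Poly_Mapping.lookup (c + d) \<alpha> * monomial_at z \<alpha>)
        = (\<Sum>\<alpha>\<in>?K. Poly_Mapping.lookup (c + d) \<alpha> * monomial_at z \<alpha>)"
      by (rule lookup_sum_extend_keys) (simp_all add: Poly_Mapping.keys_add)
    ultimately show ?thesis
      by (simp add: lookup_add distrib_right sum.distrib)
  qed
  then show ?thesis unfolding hol_poly_fun_def by blast
qed

lemma hol_poly_fun_const: "hol_poly_fun (\<lambda>_. c)"
  using hol_poly_fun_monomial[of c "\<lambda>_. 0"] by (simp add: monomial_at_def)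

lemma hol_poly_fun_nth: "hol_poly_fun (\<lambda>z. z $ i)"
proof -
  have "z $ j ^ (if j = i then 1 else 0) = (if j = i then z $ j else 1)" for z :: "complex ^ 'a" and j
    by simp
  then show ?thesis
    using hol_poly_fun_monomial[of 1 "\<lambda>j. if j = i then 1 else 0"]
    by (simp add: monomial_at_def del: power_0 cong: if_cong)
qed

lemma hol_poly_fun_sum:
  assumes "finite I" "\<And>i. i \<in> I \<Longrightarrow> hol_poly_fun (h i)"
  shows "hol_poly_fun (\<lambda>z. \<Sum>i\<in>I. h i z)"
  using assms hol_poly_fun_const[of 0] hol_poly_fun_add
  by (rule sum_closed[where P = hol_poly_fun])

text \<open>The product is a double sum of monomials, to which closure under sums applies without
  collecting coefficients.\<close>

lemma hol_poly_fun_mult: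
  assumes "hol_poly_fun h" "hol_poly_fun k"
  shows "hol_poly_fun (\<lambda>z. h z * k z)"
proof -
  obtain c d where
    c: "\<And>z. h z = (\<Sum>\<alpha>\<in>Poly_Mapping.keys c. Poly_Mapping.lookup c \<alpha> * monomial_at z \<alpha>)" and
    d: "\<And>z. k z = (\<Sum>\<alpha>\<in>Poly_Mapping.keys d. Poly_Mapping.lookup d \<alpha> * monomial_at z \<alpha>)"
    using assms unfolding hol_poly_fun_def by blast
  have "h z * k z = (\<Sum>\<alpha>\<in>Poly_Mapping.keys c. \<Sum>\<beta>\<in>Poly_Mapping.keys d.
      (Poly_Mapping.lookup c \<alpha> * Poly_Mapping.lookup d \<beta>) * monomial_at z (\<lambda>i. \<alpha> i + \<beta> i))" for z
    unfolding c d sum_product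
    by (intro sum.cong refl) (simp add: monomial_at_def power_add prod.distrib mult_ac)
  then show ?thesis
    by (simp only:) (intro hol_poly_fun_sum hol_poly_fun_monomial finite_keys)
qed

text \<open>Hides the coefficient family: boundedness of holomorphic polynomials is later checked on
  generators and operations only.\<close>

lemma hol_poly_fun_induct [consumes 1, case_names const nth add mult]:
  assumes "hol_poly_fun h"
    and const: "\<And>c. P (\<lambda>_. c)" and nth: "\<And>i. P (\<lambda>z. z $ i)"
    and add: "\<And>h k. P h \<Longrightarrow> P k \<Longrightarrow> P (\<lambda>z. h z + k z)"
    and mult: "\<And>h k. P h \<Longrightarrow> P k \<Longrightarrow> P (\<lambda>z. h z * k z)"
  shows "P h"
proof -
  obtain c where
    c: "h = (\<lambda>z. \<Sum>\<alpha>\<in>Poly_Mapping.keys c. Poly_Mapping.lookup c \<alpha> * monomial_at z \<alpha>)"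
    using assms(1) unfolding hol_poly_fun_def by blast
  have pow: "P (\<lambda>z. z $ i ^ n)" for i n
    by (rule power_closed[where P = P]) (rule nth const | (erule mult, assumption))+
  have "P (\<lambda>z. \<Prod>i\<in>UNIV. z $ i ^ \<alpha> i)" for \<alpha>
    by (intro prod_closed[where P = P]) (rule pow finite const | (erule mult, assumption))+
  then have "P (\<lambda>z. monomial_at z \<alpha>)" for \<alpha>
    unfolding monomial_at_def .
  then have summand: "P (\<lambda>z. Poly_Mapping.lookup c \<alpha> * monomial_at z \<alpha>)" for \<alpha>
    by (intro mult[OF const])
  show ?thesis
    unfolding c
    by (rule sum_closed[where P = P]) (rule summand finite_keys const | (erule add, assumption))+
qed

text \<open>Serves both the boundedness of all polynomials and the identification of characters with
  point evaluations.\<close>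

lemma zzbar_eval_induct [case_names const nth cnj add mult]:
  assumes const: "\<And>c. P (\<lambda>_. c)" and nth: "\<And>i. P (\<lambda>z. z $ i)"
    and cnj: "\<And>i. P (\<lambda>z. cnj (z $ i))"
    and add: "\<And>h k. P h \<Longrightarrow> P k \<Longrightarrow> P (\<lambda>z. h z + k z)"
    and mult: "\<And>h k. P h \<Longrightarrow> P k \<Longrightarrow> P (\<lambda>z. h z * k z)"
  shows "P (zzbar_eval f)"
proof -
  have pow: "P (\<lambda>z. z $ i ^ n)" for i n
    by (rule power_closed[where P = P]) (rule nth const | (erule mult, assumption))+
  have "P (\<lambda>z. \<Prod>i\<in>UNIV. z $ i ^ \<alpha> i)" for \<alpha>
    by (intro prod_closed[where P = P]) (rule pow finite const | (erule mult, assumption))+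
  then have "P (\<lambda>z. monomial_at z \<alpha>)" for \<alpha>
    unfolding monomial_at_def .
  moreover have "P (\<lambda>z. monomial_at (conj_vec z) \<beta>)" for \<beta>
  proof -
    have pow: "P (\<lambda>z. cnj (z $ i) ^ n)" for i n
      by (rule power_closed[where P = P]) (rule cnj const | (erule mult, assumption))+
    have "P (\<lambda>z. \<Prod>i\<in>UNIV. cnj (z $ i) ^ \<beta> i)"
      by (intro prod_closed[where P = P]) (rule pow finite const | (erule mult, assumption))+
    then show ?thesis
      unfolding monomial_at_def conj_vec_def vec_lambda_beta .
  qed
  ultimately have summand: "P (\<lambda>z. Poly_Mapping.lookup f (\<alpha>, \<beta>) * monomial_at z \<alpha> * monomial_at (conj_vec z) \<beta>)"
    for \<alpha> \<beta>
    by (intro mult[OF mult[OF const]])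
  show ?thesis
    unfolding zzbar_eval_def[abs_def] case_prod_unfold prod.collapse
    by (rule sum_closed[where P = P])
      (rule summand[of "fst x" "snd x" for x, unfolded prod.collapse] finite_keys const
        | (erule add, assumption))+
qed

section \<open>Squared norms on the sphere\<close>

text \<open>The components of \<open>g\<close> form a list, so that addition becomes concatenation.
  Membership depends only on values on the sphere, which builds the relation
  \<open>norm z = 1\<close> into the semiring.\<close>

definition sphere_norm_squares :: "(complex ^ 'n::finite \<Rightarrow> real) set" where
  "sphere_norm_squares = {F. \<exists>hs. (\<forall>h\<in>set hs. hol_poly_fun h) \<and>
     (\<forall>z. norm z = 1 \<longrightarrow> F z = (\<Sum>h\<leftarrow>hs. (cmod (h z))\<^sup>2))}"

lemma sphere_norm_squares_cong:
  assumes "F \<in> sphere_norm_squares" "\<And>z. norm z = 1 \<Longrightarrow> F z = G z"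
  shows "G \<in> sphere_norm_squares"
  using assms unfolding sphere_norm_squares_def by auto

lemma sphere_norm_squares_single:
  "hol_poly_fun h \<Longrightarrow> (\<lambda>z. (cmod (h z))\<^sup>2) \<in> sphere_norm_squares"
  unfolding sphere_norm_squares_def by (intro CollectI exI[of _ "[h]"]) simp

lemma sphere_norm_squares_add:
  assumes "F \<in> sphere_norm_squares" "G \<in> sphere_norm_squares"
  shows "F + G \<in> sphere_norm_squares"
proof -
  obtain hs ks where
    "\<forall>h\<in>set hs. hol_poly_fun h" "\<forall>z. norm z = 1 \<longrightarrow> F z = (\<Sum>h\<leftarrow>hs. (cmod (h z))\<^sup>2)"
    "\<forall>h\<in>set ks. hol_poly_fun h" "\<forall>z. norm z = 1 \<longrightarrow> G z = (\<Sum>h\<leftarrow>ks. (cmod (h z))\<^sup>2)"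
    using assms unfolding sphere_norm_squares_def by blast
  then show ?thesis
    unfolding sphere_norm_squares_def by (intro CollectI exI[of _ "hs @ ks"]) auto
qed

text \<open>The tensor product of two maps has all products of components as its components, and its
  squared norm is the product of theirs.\<close>

lemma sphere_norm_squares_mult:
  assumes "F \<in> sphere_norm_squares" "G \<in> sphere_norm_squares"
  shows "F * G \<in> sphere_norm_squares"
proof -
  obtain hs ks where hs:
    "\<forall>h\<in>set hs. hol_poly_fun h" "\<forall>z. norm z = 1 \<longrightarrow> F z = (\<Sum>h\<leftarrow>hs. (cmod (h z))\<^sup>2)"
    and ks: "\<forall>h\<in>set ks. hol_poly_fun h" "\<forall>z. norm z = 1 \<longrightarrow> G z = (\<Sum>h\<leftarrow>ks. (cmod (h z))\<^sup>2)"
    using assms unfolding sphere_norm_squares_def by blast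
  let ?ps = "concat (map (\<lambda>h. map (\<lambda>k z. h z * k z) ks) hs)"
  have row: "(\<Sum>p\<leftarrow>map (\<lambda>k z. h z * k z) ks. (cmod (p z))\<^sup>2)
      = (cmod (h z))\<^sup>2 * (\<Sum>k\<leftarrow>ks. (cmod (k z))\<^sup>2)" for h z
    by (induction ks) (simp_all add: norm_mult power_mult_distrib distrib_left)
  have "(\<Sum>p\<leftarrow>?ps. (cmod (p z))\<^sup>2)
      = (\<Sum>h\<leftarrow>hs. (cmod (h z))\<^sup>2) * (\<Sum>k\<leftarrow>ks. (cmod (k z))\<^sup>2)" for z
    using row by (induction hs) (simp_all add: distrib_right)
  moreover have "\<forall>p\<in>set ?ps. hol_poly_fun p"
    using hs(1) ks(1) by (auto intro: hol_poly_fun_mult)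
  ultimately show ?thesis
    unfolding sphere_norm_squares_def using hs(2) ks(2)
    by (intro CollectI exI[of _ ?ps]) simp
qed

lemma sphere_norm_squares_of_real:
  assumes "0 \<le> r"
  shows "of_real r \<in> sphere_norm_squares"
  using sphere_norm_squares_single[OF hol_poly_fun_const[of "of_real (sqrt r)"]] assms
  by (simp add: of_real_fun)

lemma norm_vec_complex_squared: "(norm z)\<^sup>2 = (\<Sum>i\<in>UNIV. (cmod (z $ i))\<^sup>2)"
  for z :: "complex ^ 'n::finite"
  by (simp add: norm_vec_def L2_set_def sum_nonneg)

text \<open>Taking \<open>u\<close> to be \<open>1\<close>, \<open>- 1\<close>, \<open>\<i>\<close>
  and \<open>- \<i>\<close> bounds the real and imaginary parts of each coordinate by
  \<open>1\<close>.\<close>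

lemma sphere_one_plus_Re_nth:
  fixes i :: "'n::finite"
  assumes "cmod u = 1"
  shows "(\<lambda>z. 1 + Re (u * z $ i)) \<in> sphere_norm_squares"
proof -
  have "(\<lambda>z :: complex ^ 'n. \<Sum>j\<in>UNIV - {i}. (cmod (z $ j))\<^sup>2) \<in> sphere_norm_squares"
  proof (rule sum_closed[where P = "\<lambda>F. F \<in> sphere_norm_squares"])
    show "(\<lambda>_. 0) \<in> sphere_norm_squares"
      using sphere_norm_squares_of_real[of 0] by (simp add: zero_fun_def)
  qed (use sphere_norm_squares_add in \<open>auto simp: plus_fun_def intro!: sphere_norm_squares_single hol_poly_fun_nth\<close>)
  then have "of_real (1/2) * ((\<lambda>z. (cmod (1 + u * z $ i))\<^sup>2)
      + (\<lambda>z :: complex ^ 'n. \<Sum>j\<in>UNIV - {i}. (cmod (z $ j))\<^sup>2)) \<in> sphere_norm_squares"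
    by (intro sphere_norm_squares_mult sphere_norm_squares_add sphere_norm_squares_of_real
        sphere_norm_squares_single hol_poly_fun_add hol_poly_fun_mult hol_poly_fun_const
        hol_poly_fun_nth) simp_all
  then show ?thesis
  proof (rule sphere_norm_squares_cong)
    fix z :: "complex ^ 'n" assume z: "norm z = 1"
    have "(\<Sum>j\<in>UNIV - {i}. (cmod (z $ j))\<^sup>2) = 1 - (cmod (z $ i))\<^sup>2"
      using norm_vec_complex_squared[of z] z by (simp add: sum_diff1)
    moreover have "(cmod (1 + x))\<^sup>2 = 1 + 2 * Re x + (cmod x)\<^sup>2" for x
      unfolding cmod_power2 by (simp add: power2_eq_square algebra_simps)
    ultimately show "(of_real (1/2) * ((\<lambda>z. (cmod (1 + u * z $ i))\<^sup>2)
      + (\<lambda>z. \<Sum>j\<in>UNIV - {i}. (cmod (z $ j))\<^sup>2))) z = 1 + Re (u * z $ i)"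
      using assms by (simp add: norm_mult)
  qed
qed

section \<open>Boundedness of polynomials on the sphere\<close>

lemmas bounded_sphere_add = bounded_elements_add[OF sphere_norm_squares_add]
  and bounded_sphere_mult = bounded_elements_mult[OF sphere_norm_squares_add
    sphere_norm_squares_mult sphere_norm_squares_of_real]
  and bounded_sphere_of_real = bounded_elements_of_real[OF sphere_norm_squares_of_real]

text \<open>The semiring consists of real functions, so complex ones enter through their two real
  components, which multiplication mixes.\<close>

abbreviation sphere_bounded :: "(complex ^ 'n::finite \<Rightarrow> complex) \<Rightarrow> bool" where
  "sphere_bounded u \<equiv> (\<lambda>z. Re (u z)) \<in> bounded_elements sphere_norm_squares \<and>
     (\<lambda>z. Im (u z)) \<in> bounded_elements sphere_norm_squares"

lemma sphere_bounded_const: "sphere_bounded (\<lambda>_. c)"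
  using bounded_sphere_of_real[of "Re c"] bounded_sphere_of_real[of "Im c"]
  by (simp add: of_real_fun)

lemma sphere_bounded_nth: "sphere_bounded (\<lambda>z. z $ i)"
  unfolding bounded_elements_def
  using sphere_one_plus_Re_nth[of 1 i] sphere_one_plus_Re_nth[of "- 1" i]
    sphere_one_plus_Re_nth[of "\<i>" i] sphere_one_plus_Re_nth[of "- \<i>" i]
  by (intro conjI CollectI exI[of _ 1]) (simp_all add: plus_fun_def fun_diff_def one_fun_def)

lemma sphere_bounded_cnj:
  assumes "sphere_bounded u"
  shows "sphere_bounded (\<lambda>z. cnj (u z))"
  using assms bounded_elements_uminus[of "\<lambda>z. Im (u z)"] by (simp add: fun_Compl_def)

lemma sphere_bounded_add:
  assumes "sphere_bounded u" "sphere_bounded v"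
  shows "sphere_bounded (\<lambda>z. u z + v z)"
  using assms bounded_sphere_add[of "\<lambda>z. Re (u z)" "\<lambda>z. Re (v z)"]
    bounded_sphere_add[of "\<lambda>z. Im (u z)" "\<lambda>z. Im (v z)"]
  by (simp add: plus_fun_def)

text \<open>The form \<open>+ -\<close> instead of subtraction fits the closure rules for sums and
  negatives.\<close>

lemma Re_Im_fun_mult:
  "(\<lambda>z. Re (u z * v z)) = (\<lambda>z. Re (u z)) * (\<lambda>z. Re (v z)) + - ((\<lambda>z. Im (u z)) * (\<lambda>z. Im (v z)))"
  "(\<lambda>z. Im (u z * v z)) = (\<lambda>z. Re (u z)) * (\<lambda>z. Im (v z)) + (\<lambda>z. Im (u z)) * (\<lambda>z. Re (v z))"
  by (simp_all add: fun_eq_iff)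

lemma sphere_bounded_mult:
  assumes "sphere_bounded u" "sphere_bounded v"
  shows "sphere_bounded (\<lambda>z. u z * v z)"
  unfolding Re_Im_fun_mult using assms
  by (intro conjI bounded_sphere_add bounded_sphere_mult bounded_elements_uminus) simp_all

lemma sphere_bounded_zzbar_eval: "sphere_bounded (zzbar_eval f)"
  by (rule zzbar_eval_induct)
    (intro sphere_bounded_const sphere_bounded_nth sphere_bounded_cnj sphere_bounded_add
      sphere_bounded_mult; assumption)+

lemma sphere_bounded_hol_poly_fun: "hol_poly_fun h \<Longrightarrow> sphere_bounded h"
  by (erule hol_poly_fun_induct)
    (intro sphere_bounded_const sphere_bounded_nth sphere_bounded_add sphere_bounded_mult;
      assumption)+

text \<open>Each squared modulus is bounded, being \<open>h z * cnj (h z)\<close>. Since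
  \<open>F\<close> is known only on the sphere, the bound is found for the explicit sum and then
  transferred.\<close>

lemma archimedean_semiring_sphere: "archimedean_semiring sphere_norm_squares"
proof
  fix F :: "complex ^ 'n \<Rightarrow> real" assume "F \<in> sphere_norm_squares"
  then obtain hs where hs: "\<forall>h\<in>set hs. hol_poly_fun h"
    and F: "\<And>z. norm z = 1 \<Longrightarrow> F z = (\<Sum>h\<leftarrow>hs. (cmod (h z))\<^sup>2)"
    unfolding sphere_norm_squares_def by blast
  from hs have "(\<lambda>z. \<Sum>h\<leftarrow>hs. (cmod (h z))\<^sup>2) \<in> bounded_elements sphere_norm_squares"
  proof (induction hs)
    case Nil
    then show ?case using bounded_sphere_of_real[of 0] by (simp add: zero_fun_def)
  next
    case (Cons h hs)
    have "sphere_bounded h"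
      using Cons.prems by (intro sphere_bounded_hol_poly_fun) simp
    then have "sphere_bounded (\<lambda>z. h z * cnj (h z))"
      by (intro sphere_bounded_mult sphere_bounded_cnj) auto
    then have "(\<lambda>z. (cmod (h z))\<^sup>2) \<in> bounded_elements sphere_norm_squares"
      by (simp add: complex_mult_cnj cmod_power2)
    then show ?case
      using Cons bounded_sphere_add[of "\<lambda>z. (cmod (h z))\<^sup>2" "\<lambda>z. \<Sum>h\<leftarrow>hs. (cmod (h z))\<^sup>2"]
      by (simp add: plus_fun_def)
  qed
  then obtain k where "of_real k - (\<lambda>z. \<Sum>h\<leftarrow>hs. (cmod (h z))\<^sup>2) \<in> sphere_norm_squares"
    unfolding bounded_elements_def by blast
  then have "of_real k - F \<in> sphere_norm_squares"
    by (rule sphere_norm_squares_cong) (simp add: F)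
  then show "\<exists>k. of_real k - F \<in> sphere_norm_squares" by blast
qed (simp_all add: sphere_norm_squares_add sphere_norm_squares_mult sphere_norm_squares_of_real)

text \<open>\<phi> and evaluation at \<open>w\<close> both respect sums and products and agree on
  constants, coordinates and their conjugates, hence on all polynomials.\<close>

lemma sphere_character_is_evaluation:
  fixes \<phi> :: "(complex ^ 'n::finite \<Rightarrow> real) \<Rightarrow> real"
  assumes \<phi>: "nonneg_character sphere_norm_squares \<phi>"
  obtains w :: "complex ^ 'n" where "norm w = 1" "\<And>f. \<phi> (\<lambda>z. Re (zzbar_eval f z)) = Re (zzbar_eval f w)"
proof -
  let ?B = "bounded_elements (sphere_norm_squares :: (complex ^ 'n \<Rightarrow> real) set)"
  have \<phi>_add: "\<phi> (F + G) = \<phi> F + \<phi> G" and \<phi>_mult: "\<phi> (F * G) = \<phi> F * \<phi> G"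
    if "F \<in> ?B" "G \<in> ?B" for F G
    using \<phi> that unfolding nonneg_character_def by blast+
  have \<phi>_real: "\<phi> (of_real r) = r" and \<phi>_nonneg: "F \<in> sphere_norm_squares \<Longrightarrow> 0 \<le> \<phi> F" for r F
    using \<phi> unfolding nonneg_character_def by blast+
  have \<phi>_uminus: "\<phi> (- F) = - \<phi> F" if "F \<in> ?B" for F
    using \<phi>_add[OF that bounded_elements_uminus[OF that]] \<phi>_real[of 0] by simp
  define w :: "complex ^ 'n" where
    "w = (\<chi> i. Complex (\<phi> (\<lambda>z. Re (z $ i))) (\<phi> (\<lambda>z. Im (z $ i))))"
  \<comment> \<open>Boundedness is part of \<open>P\<close> because \<phi> is known to be additive
    and multiplicative only on bounded elements.\<close>
  define P where "P u \<longleftrightarrow> sphere_bounded u \<and> \<phi> (\<lambda>z. Re (u z)) = Re (u w) \<and> \<phi> (\<lambda>z. Im (u z)) = Im (u w)"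
    for u
  have P_const: "P (\<lambda>_. c)" for c
    unfolding P_def using sphere_bounded_const[of c] \<phi>_real[of "Re c"] \<phi>_real[of "Im c"]
    by (simp add: of_real_fun)
  have P_nth: "P (\<lambda>z. z $ i)" for i
    unfolding P_def using sphere_bounded_nth[of i] by (simp add: w_def)
  have P_cnj: "P (\<lambda>z. cnj (u z))" if "P u" for u
    using that sphere_bounded_cnj[of u] \<phi>_uminus[of "\<lambda>z. Im (u z)"]
    unfolding P_def by (simp add: fun_Compl_def)
  have P_add: "P (\<lambda>z. u z + v z)" if "P u" "P v" for u v
    using that sphere_bounded_add[of u v] \<phi>_add[of "\<lambda>z. Re (u z)" "\<lambda>z. Re (v z)"]
      \<phi>_add[of "\<lambda>z. Im (u z)" "\<lambda>z. Im (v z)"]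
    unfolding P_def by (simp add: plus_fun_def)
  have P_mult: "P (\<lambda>z. u z * v z)" if "P u" "P v" for u v
  proof -
    have "sphere_bounded u" "sphere_bounded v" using that unfolding P_def by auto
    then show ?thesis
      using sphere_bounded_mult[of u v] that unfolding P_def Re_Im_fun_mult
      by (simp add: \<phi>_add \<phi>_mult \<phi>_uminus bounded_sphere_mult bounded_elements_uminus
          del: add_uminus_conv_diff)
  qed
  have "P (zzbar_eval f)" for f
    by (rule zzbar_eval_induct) (auto intro: P_const P_nth P_cnj P_add P_mult)
  then have eval: "\<phi> (\<lambda>z. Re (zzbar_eval f z)) = Re (zzbar_eval f w)" for f
    unfolding P_def by blast
  \<comment> \<open>Writing the squared norm as a polynomial in coordinates and conjugates lets
    \<open>P\<close> compute its value under \<phi>.\<close>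
  define G where "G = (\<lambda>z :: complex ^ 'n. Re (\<Sum>i\<in>UNIV. z $ i * cnj (z $ i)))"
  have G_eq: "G z = (norm z)\<^sup>2" for z
    unfolding G_def norm_vec_complex_squared by (simp add: complex_mult_cnj cmod_power2)
  have "P (\<lambda>z. \<Sum>i\<in>UNIV. z $ i * cnj (z $ i))"
    by (rule sum_closed[where P = P]) (auto intro: P_mult[OF P_nth P_cnj[OF P_nth]] P_const P_add)
  then have G: "G \<in> ?B" "\<phi> G = (norm w)\<^sup>2"
    unfolding P_def G_eq[of w, symmetric] unfolding G_def by blast+
  have one: "1 \<in> ?B" using bounded_sphere_of_real[of 1] by simp
  \<comment> \<open>\<open>G - 1\<close> and \<open>1 - G\<close> agree with \<open>0\<close> on the
    sphere, so both lie in the semiring and nonnegativity forces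
    \<open>\<phi> G = 1\<close>.\<close>
  have "of_real 0 \<in> (sphere_norm_squares :: (complex ^ 'n \<Rightarrow> real) set)"
    by (rule sphere_norm_squares_of_real) simp
  then have "G + - 1 \<in> sphere_norm_squares" "1 + - G \<in> sphere_norm_squares"
    by (rule sphere_norm_squares_cong; simp add: G_eq)+
  from this[THEN \<phi>_nonneg] have "(norm w)\<^sup>2 = 1"
    using G one \<phi>_real[of 1] by (simp add: \<phi>_add \<phi>_uminus bounded_elements_uminus del: add_uminus_conv_diff)
  then have "norm w = 1" by (simp add: power2_eq_1_iff) (smt (verit) norm_ge_zero)
  then show thesis using eval that by blast
qed

section \<open>From a list of squares to a polynomial mapping\<close>

theorem theorem3:
  fixes f :: "'n::finite zzbar_poly" and m :: nat
  assumes "zzbar_degree f = m"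
    and "zzbar_real_valued f"
    and "\<And>z :: complex ^ 'n. norm z = 1 \<Longrightarrow> Re (zzbar_eval f z) > 0"
  shows "\<exists>(N::nat) (g :: complex ^ 'n \<Rightarrow> nat \<Rightarrow> complex).
    N \<ge> 1 \<and> hol_poly_map N g \<and>
    (\<forall>z. norm z = 1 \<longrightarrow> zzbar_eval f z = complex_of_real ((cnorm N (g z))\<^sup>2))"
proof -
  have "(\<lambda>z. Re (zzbar_eval f z)) \<in> sphere_norm_squares"
  proof (rule archimedean_semiring.kadison_dubois[OF archimedean_semiring_sphere])
    show "(\<lambda>z. Re (zzbar_eval f z)) \<in> bounded_elements sphere_norm_squares"
      using sphere_bounded_zzbar_eval by blast
    fix \<phi> :: "(complex ^ 'n \<Rightarrow> real) \<Rightarrow> real"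
    assume "nonneg_character sphere_norm_squares \<phi>"
    then obtain w :: "complex ^ 'n" where "norm w = 1"
      "\<phi> (\<lambda>z. Re (zzbar_eval f z)) = Re (zzbar_eval f w)"
      using sphere_character_is_evaluation by blast
    then show "0 < \<phi> (\<lambda>z. Re (zzbar_eval f z))" using assms(3) by simp
  qed
  then obtain hs where hs: "\<forall>h\<in>set hs. hol_poly_fun h"
    and f: "\<And>z. norm z = 1 \<Longrightarrow> Re (zzbar_eval f z) = (\<Sum>h\<leftarrow>hs. (cmod (h z))\<^sup>2)"
    unfolding sphere_norm_squares_def by blast
  \<comment> \<open>An appended zero component gives \<open>N \<ge> 1\<close> for every
    list.\<close>
  define N where "N = Suc (length hs)"
  define g where "g z j = (if j < length hs then (hs ! j) z else 0)" for z j
  have "hol_poly_fun (\<lambda>z. g z j)" for j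
    using hs hol_poly_fun_const[of 0] unfolding g_def by (cases "j < length hs") auto
  then have "hol_poly_map N g"
    unfolding hol_poly_map_def by blast
  moreover have "zzbar_eval f z = complex_of_real ((cnorm N (g z))\<^sup>2)" if "norm z = 1" for z
  proof -
    have "(cnorm N (g z))\<^sup>2 = (\<Sum>j<N. (cmod (g z j))\<^sup>2)"
      unfolding cnorm_def L2_set_def by (simp add: sum_nonneg)
    also have "\<dots> = (\<Sum>j<length hs. (cmod ((hs ! j) z))\<^sup>2)"
      unfolding N_def g_def by simp
    also have "\<dots> = Re (zzbar_eval f z)"
      unfolding f[OF that] by (simp add: sum_list_sum_nth atLeast0LessThan)
    \<comment> \<open>So far only real parts are compared; real-valuedness of \<open>f\<close> gives
      the complex equality.\<close>
    finally show ?thesis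
      using assms(2) unfolding zzbar_real_valued_def by simp
  qed
  moreover have "N \<ge> 1" unfolding N_def by simp
  ultimately show ?thesis by blast
qed

end
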